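(* Let $n\in\mathbb{N}$ and let $a,b$ be positive real numbers. For $c,d>\max\{a,b\}$ let $P_n(x;a,b;c,d)$ be the degree-$n$ element of the monic $2$-orthogonal polynomial sequence with respect to the weight vector $\overline{\mathcal{W}}(x;a,b;c,d)$. Then, for every $x$: for each fixed $c>\max\{a,b\}$, $$\lim_{d\to\infty}d^{\,n}P_n\!\left(\frac xd;a,b;c,d\right)=R_n^{[0]}(x;a,b;c),$$ and, for each fixed $d>\max\{a,b\}$, $$\lim_{c\to\infty}c^{\,n}P_n\!\left(\frac xc;a,b;c,d\right)=R_n^{[1]}(x;a,b;d-1).$$
   Context: $\mathbb{N}=\{0,1,2,\dots\}$; $(z)_0=1$ and $(z)_n=z(z+1)\cdots(z+n-1)$; ${}_pF_q(\alpha_1,\dots,\alpha_p;\beta_1,\dots,\beta_q;z)=\sum_{j\ge0}\frac{(\alpha_1)_j\cdots(\alpha_p)_j}{(\beta_1)_j\cdots(\beta_q)_j}\frac{z^j}{j!}$. For $\epsilon\in\{0,1\}$, $$R_n^{[\epsilon]}(x;a,b;c)=\frac{(-1)^n(a)_n(b)_n}{\left(c+\left\lfloor\frac{n+\epsilon}2\right\rfloor\right)_n}\;{}_2F_2\!\left(\begin{matrix}-n,\ c+\left\lfloor\frac{n+\epsilon}2\right\rfloor\\ a,\ b\end{matrix};x\right),$$ a monic polynomial of degree $n$ (these are $2$-orthogonal polynomials associated with Tricomi-function weights). For positive reals $a,b,c,d$ with $\delta:=c+d-a-b>0$, the function $\mathcal{W}(\cdot\,;a,b;c,d)$ on $(0,1)$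 is $$\mathcal{W}(x;a,b;c,d)=\frac{\Gamma(c)\Gamma(d)}{\Gamma(a)\Gamma(b)\Gamma(\delta)}\,x^{a-1}(1-x)^{\delta-1}\,{}_2F_1(c-b,d-b;\delta;1-x).$$ The weight vector $\overline{\mathcal{W}}(x;a,b;c,d)$ has components $w_0(x)=\mathcal{W}(x;a,b;c,d)$ and $w_1(x)=\mathcal{W}(x;a,b+1;c+1,d)$. A sequence of monic polynomials $\{P_n\}_{n\in\mathbb{N}}$ with $\deg P_n=n$ is the monic $2$-orthogonal polynomial sequence with respect to $\overline{\mathcal{W}}(x;a,b;c,d)$ if, for each $j\in\{0,1\}$ and $k,n\in\mathbb{N}$, $\int_0^1x^kP_n(x)w_j(x)\,\mathrm{d}x$ equals $0$ if $n\ge 2k+j+1$ and is nonzero if $n=2k+j$. For $\min\{c,d\}>\max\{a,b\}$ it exists and is unique. *)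

theory Defs
  imports "HOL-Analysis.Analysis" "HOL-Computational_Algebra.Polynomial"
begin

text \<open>The generalized hypergeometric series \<open>\<^sub>pF\<^sub>q(as; bs; z)\<close>, with the parameters given as lists.\<close>

definition hypergeom :: "real list \<Rightarrow> real list \<Rightarrow> real \<Rightarrow> real" where
  "hypergeom as bs z =
     (\<Sum>j. (\<Prod>\<alpha>\<leftarrow>as. pochhammer \<alpha> j) / (\<Prod>\<beta>\<leftarrow>bs. pochhammer \<beta> j) * (z ^ j / fact j))"

definition tricomi_R :: "nat \<Rightarrow> nat \<Rightarrow> real \<Rightarrow> real \<Rightarrow> real \<Rightarrow> real \<Rightarrow> real" where
  "tricomi_R \<epsilon> n a b c x =
     (let c' = c + real ((n + \<epsilon>) div 2) in
        (-1) ^ n * pochhammer a n * pochhammer b n / pochhammer c' n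
          * hypergeom [- real n, c'] [a, b] x)"

text \<open>Only the values for \<open>0 < x < 1\<close> are relevant.\<close>

definition hg_weight :: "real \<Rightarrow> real \<Rightarrow> real \<Rightarrow> real \<Rightarrow> real \<Rightarrow> real" where
  "hg_weight a b c d x =
     (let \<delta> = c + d - a - b in
        Gamma c * Gamma d / (Gamma a * Gamma b * Gamma \<delta>)
          * x powr (a - 1) * (1 - x) powr (\<delta> - 1)
          * hypergeom [c - b, d - b] [\<delta>] (1 - x))"

definition hg_weight_vec :: "real \<Rightarrow> real \<Rightarrow> real \<Rightarrow> real \<Rightarrow> nat \<Rightarrow> real \<Rightarrow> real" where
  "hg_weight_vec a b c d j =
     (if j = 0 then hg_weight a b c d else hg_weight a (b + 1) (c + 1) d)"

text \<open>
  Monic 2-orthogonality on \<open>(0, 1)\<close> with respect to the weights \<open>w 0\<close> and \<open>w 1\<close>.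
  The integrals are Lebesgue integrals; both components of \<open>hg_weight_vec a b c d\<close> are absolutely
  integrable on \<open>(0, 1)\<close> when \<open>a, b > 0\<close> and \<open>c, d > max a b\<close>.
\<close>

definition monic_2OPS :: "(nat \<Rightarrow> real \<Rightarrow> real) \<Rightarrow> (nat \<Rightarrow> real poly) \<Rightarrow> bool" where
  "monic_2OPS w P \<longleftrightarrow>
     (\<forall>n. degree (P n) = n \<and> lead_coeff (P n) = 1) \<and>
     (\<forall>j\<in>{0, 1}. \<forall>k n.
        (n \<ge> 2 * k + j + 1 \<longrightarrow>
           (LBINT x:{0<..<1}. x ^ k * poly (P n) x * w j x) = 0) \<and>
        (n = 2 * k + j \<longrightarrow>
           (LBINT x:{0<..<1}. x ^ k * poly (P n) x * w j x) \<noteq> 0))"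

end

theory Submission
  imports Defs "HOL-Real_Asymp.Real_Asymp"
begin

text \<open>
  The moments of \<open>hg_weight a b c d\<close> are \<open>(a)\<^sub>k (b)\<^sub>k / ((c)\<^sub>k (d)\<^sub>k)\<close>: integrate the series for
  \<open>\<^sub>2F\<^sub>1\<close> termwise and apply Gauss's summation theorem, which follows in turn from Euler's integral.
  Hence \<open>P\<^sub>n\<close> is the monic multiple of
  \<open>\<^sub>3F\<^sub>2(-n, c + \<lfloor>n/2\<rfloor>, d + \<lfloor>(n-1)/2\<rfloor>; a, b; x)\<close>: integrating this polynomial against \<open>x\<^sup>k w\<^sub>j\<close>
  gives an \<open>n\<close>-th finite difference of a polynomial of degree \<open>n - 1\<close>, and the orthogonality
  conditions form a triangular system. The limits are then taken coefficientwise.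
\<close>

section \<open>Termwise integration of one-signed series\<close>

abbreviation unit_interval_measure :: "real measure" where
  "unit_interval_measure \<equiv> restrict_space lborel {0<..<1}"

text \<open>From index 1 on the partial sums are monotone up to the sign \<sigma>, so
  \<open>\<bar>f 0 x\<bar> + \<bar>F x - f 0 x\<bar>\<close> dominates all of them once
  \<open>F\<close> is integrable. Conversely, the norms of these terms are \<sigma> times the terms,
  so convergence of the integrals is already absolute. The first form evaluates a series from a
  known integral, the second an integral from a known series. Index 0 is exempt because (A)_0 = 1 is
  positive even when A is negative.\<close>

lemma
  fixes f :: "nat \<Rightarrow> 'a \<Rightarrow> real"
  assumes int: "\<And>j. integrable M (f j)"
    and \<sigma>: "\<bar>\<sigma>\<bar> = 1"
    and sgn: "\<And>j x. x \<in> space M \<Longrightarrow> 0 \<le> \<sigma> * f (Suc j) x"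
    and sums: "\<And>x. x \<in> space M \<Longrightarrow> (\<lambda>j. f j x) sums F x"
  shows sums_integral_of_integrable_one_signed:
      "integrable M F \<Longrightarrow> (\<lambda>j. integral\<^sup>L M (f j)) sums integral\<^sup>L M F"
    and has_bochner_integral_sums_one_signed:
      "(\<lambda>j. integral\<^sup>L M (f j)) sums s \<Longrightarrow> has_bochner_integral M F s"
proof -
  assume F: "integrable M F"
  have bound: "norm (\<Sum>j<N. f j x) \<le> \<bar>f 0 x\<bar> + \<bar>F x - f 0 x\<bar>" if x: "x \<in> space M" for x N
  proof (cases N)
    case 0
    then show ?thesis by simp
  next
    case (Suc N')
    have "(\<lambda>j. f (Suc j) x) sums (F x - f 0 x)"
      using sums[OF x] sums_Suc_iff[of "\<lambda>j. f j x"] by simp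
    then have *: "(\<lambda>j. \<sigma> * f (Suc j) x) sums (\<sigma> * (F x - f 0 x))"
      by (rule sums_mult)
    then have "(\<Sum>j<N'. \<sigma> * f (Suc j) x) \<le> \<sigma> * (F x - f 0 x)"
      using sgn[OF x] by (metis sum_le_suminf sums_summable sums_unique finite_lessThan)
    moreover have "0 \<le> (\<Sum>j<N'. \<sigma> * f (Suc j) x)"
      using sgn[OF x] by (intro sum_nonneg) auto
    ultimately have "\<bar>\<Sum>j<N'. \<sigma> * f (Suc j) x\<bar> \<le> \<bar>\<sigma> * (F x - f 0 x)\<bar>"
      by linarith
    then have "\<bar>\<Sum>j<N'. f (Suc j) x\<bar> \<le> \<bar>F x - f 0 x\<bar>"
      using \<sigma> by (simp add: abs_mult flip: sum_distrib_left)
    then show ?thesis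
      unfolding Suc sum.lessThan_Suc_shift by simp
  qed
  have "(\<lambda>N. integral\<^sup>L M (\<lambda>x. \<Sum>j<N. f j x)) \<longlonglongrightarrow> integral\<^sup>L M F"
  proof (rule integral_dominated_convergence)
    show "integrable M (\<lambda>x. \<bar>f 0 x\<bar> + \<bar>F x - f 0 x\<bar>)"
      using int F by simp
    show "AE x in M. (\<lambda>N. \<Sum>j<N. f j x) \<longlonglongrightarrow> F x"
      using sums by (auto simp: sums_def)
  qed (use int F bound in auto)
  then show "(\<lambda>j. integral\<^sup>L M (f j)) sums integral\<^sup>L M F"
    using int by (simp add: sums_def)
next
  assume s: "(\<lambda>j. integral\<^sup>L M (f j)) sums s"
  have norm_f: "norm (f (Suc j) x) = \<sigma> * f (Suc j) x" if "x \<in> space M" for j x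
    using sgn[OF that, of j] \<sigma> by (auto simp: abs_if split: if_splits)
  have AE_sum: "AE x in M. summable (\<lambda>j. norm (f j x))"
  proof (rule AE_I2)
    fix x assume x: "x \<in> space M"
    have "summable (\<lambda>j. f (Suc j) x)"
      using sums[OF x] summable_Suc_iff[of "\<lambda>j. f j x"] by (simp add: sums_iff)
    then have "summable (\<lambda>j. norm (f (Suc j) x))"
      unfolding norm_f[OF x] by (rule summable_mult)
    then show "summable (\<lambda>j. norm (f j x))"
      using summable_Suc_iff[of "\<lambda>j. norm (f j x)"] by simp
  qed
  have "summable (\<lambda>j. integral\<^sup>L M (f (Suc j)))"
    using s summable_Suc_iff[of "\<lambda>j. integral\<^sup>L M (f j)"] by (simp add: sums_iff)
  then have "summable (\<lambda>j. \<sigma> * integral\<^sup>L M (f (Suc j)))"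
    by (rule summable_mult)
  moreover have "(\<integral>x. norm (f (Suc j) x) \<partial>M) = \<sigma> * integral\<^sup>L M (f (Suc j))" for j
    using norm_f by (subst Bochner_Integration.integral_cong[OF refl norm_f]) auto
  ultimately have "summable (\<lambda>j. \<integral>x. norm (f (Suc j) x) \<partial>M)"
    by simp
  then have int_sum: "summable (\<lambda>j. \<integral>x. norm (f j x) \<partial>M)"
    using summable_Suc_iff[of "\<lambda>j. \<integral>x. norm (f j x) \<partial>M"] by simp
  have F: "(\<Sum>j. f j x) = F x" if "x \<in> space M" for x
    using sums[OF that] by (simp add: sums_iff)
  have "integrable M (\<lambda>x. \<Sum>j. f j x)"
    by (rule integrable_suminf[OF int AE_sum int_sum])
  moreover have "integral\<^sup>L M (\<lambda>x. \<Sum>j. f j x) = s"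
    using sums_integral[OF int AE_sum int_sum] s by (metis sums_unique2)
  ultimately have "has_bochner_integral M (\<lambda>x. \<Sum>j. f j x) s"
    by (simp add: has_bochner_integral_iff)
  then show "has_bochner_integral M F s"
    by (rule has_bochner_integral_cong[THEN iffD1, rotated -1]) (use F in auto)
qed

section \<open>Beta integrals and Gauss's summation theorem\<close>

lemma has_bochner_integral_Beta:
  fixes a b :: real
  assumes "a > 0" "b > 0"
  shows "has_bochner_integral unit_interval_measure (\<lambda>t. t powr (a - 1) * (1 - t) powr (b - 1)) (Beta a b)"
proof -
  let ?f = "\<lambda>t. t powr (a - 1) * (1 - t) powr (b - 1)"
  have int: "set_integrable lborel {0<..<1} ?f"
    using integrable_Beta[OF assms] by (rule set_integrable_subset) auto
  have "(LINT t:{0<..<1}|lborel. ?f t) = integral {0<..<1} ?f"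
    using int by (rule set_borel_integral_eq_integral)
  also have "\<dots> = Beta a b"
    using has_integral_Beta_real[OF assms]
    by (simp add: has_integral_Icc_iff_Ioo integral_unique)
  finally show ?thesis
    using int by (simp add: has_bochner_integral_iff integrable_restrict_space
        integral_restrict_space set_integrable_def set_lebesgue_integral_def)
qed

lemma Beta_plus_of_nat_left:
  fixes x y :: real
  assumes "x > 0" "y > 0"
  shows "Beta (x + real j) y = pochhammer x j / pochhammer (x + y) j * Beta x y"
proof -
  have "x \<notin> \<int>\<^sub>\<le>\<^sub>0" "x + y \<notin> \<int>\<^sub>\<le>\<^sub>0"
    using assms by (auto dest: nonpos_Ints_nonpos)
  moreover have "Gamma x > 0" "Gamma (x + y) > 0" "Gamma (x + y + real j) > 0"
    using assms by (auto intro!: Gamma_real_pos add_pos_nonneg)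
  ultimately show ?thesis
    by (simp add: pochhammer_Gamma Beta_def field_simps)
qed

lemma sgn_pochhammer_Suc:
  fixes A :: real
  assumes "A > -1"
  shows "sgn (pochhammer A (Suc j)) = sgn A"
  using assms pochhammer_pos[of "A + 1" j] by (simp add: pochhammer_rec sgn_mult)

lemma binomial_series_pochhammer:
  fixes A t :: real
  assumes "\<bar>t\<bar> < 1"
  shows "(\<lambda>j. pochhammer A j / fact j * t ^ j) sums (1 - t) powr (- A)"
proof -
  have "(\<lambda>j. ((- A) gchoose j) * (- t) ^ j) sums (1 + (- t)) powr (- A)"
    using assms by (intro gen_binomial_real) simp
  moreover have "((- A) gchoose j) * (- t) ^ j = pochhammer A j / fact j * t ^ j" for j
  proof -
    have "(- 1) ^ j * (- t) ^ j = t ^ j"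
      by (simp flip: power_mult_distrib)
    then show ?thesis
      by (simp add: gbinomial_pochhammer mult_ac)
  qed
  ultimately show ?thesis by simp
qed

text \<open>
  For \<open>-1 < A < 0\<close> the terms are negative from the first one on, which is
  still enough to integrate Euler's integral termwise.
\<close>

lemma Gauss_summation:
  fixes A B C :: real
  assumes A: "A > -1" and B: "B > 0" and C: "C > B" "C > A + B"
  shows "(\<lambda>j. pochhammer A j * pochhammer B j / (pochhammer C j * fact j)) sums
           (Beta B (C - A - B) / Beta B (C - B))"
proof -
  \<comment> \<open>At argument 1 the factor (1-t)^(-A) of Euler's integral merges with
    (1-t)^(C-B-1), so the whole integrand \<open>F\<close> is again a Beta integrand. The terms
    \<open>f j\<close> arise by expanding that factor in its binomial series.\<close>
  define f where "f = (\<lambda>j t. pochhammer A j / fact j *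
      (t powr ((B + real j) - 1) * (1 - t) powr ((C - B) - 1)))"
  define F where "F = (\<lambda>t. t powr (B - 1) * (1 - t) powr ((C - A - B) - 1))"
  define \<sigma> :: real where "\<sigma> = (if A \<ge> 0 then 1 else -1)"
  have intf: "has_bochner_integral unit_interval_measure (f j)
      (pochhammer A j / fact j * Beta (B + real j) (C - B))" for j
    unfolding f_def using B C
    by (intro has_bochner_integral_mult_right has_bochner_integral_Beta) auto
  have intF: "has_bochner_integral unit_interval_measure F (Beta B (C - A - B))"
    unfolding F_def using B C by (intro has_bochner_integral_Beta) auto
  have "0 \<le> \<sigma> * pochhammer A (Suc j)" for j
    using sgn_pochhammer_Suc[OF A, of j] by (auto simp: \<sigma>_def sgn_if split: if_splits)
  then have sgn: "0 \<le> \<sigma> * f (Suc j) t" for j t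
    unfolding f_def by (metis divide_nonneg_pos fact_gt_zero mult.assoc mult_nonneg_nonneg
        powr_ge_zero times_divide_eq_right)
  have sums: "(\<lambda>j. f j t) sums F t" if "t \<in> {0<..<1}" for t
  proof -
    have t: "0 < t" "t < 1" using that by auto
    have "(\<lambda>j. pochhammer A j / fact j * t ^ j * (t powr (B - 1) * (1 - t) powr ((C - B) - 1))) sums
        ((1 - t) powr (- A) * (t powr (B - 1) * (1 - t) powr ((C - B) - 1)))"
      using t by (intro sums_mult2 binomial_series_pochhammer) simp
    moreover have "(1 - t) powr (- A) * (t powr (B - 1) * (1 - t) powr ((C - B) - 1)) = F t"
      by (simp add: F_def algebra_simps flip: powr_add)
    moreover have "t powr ((B + real j) - 1) = t ^ j * t powr (B - 1)" for j
      using t by (simp add: algebra_simps flip: powr_realpow powr_add)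
    ultimately show ?thesis
      by (simp add: f_def mult.assoc)
  qed
  have "(\<lambda>j. integral\<^sup>L unit_interval_measure (f j)) sums integral\<^sup>L unit_interval_measure F"
    by (rule sums_integral_of_integrable_one_signed[where \<sigma> = \<sigma>])
       (use intf intF sgn sums in \<open>auto simp: has_bochner_integral_iff \<sigma>_def space_restrict_space\<close>)
  then have "(\<lambda>j. pochhammer A j / fact j * Beta (B + real j) (C - B)) sums Beta B (C - A - B)"
    using intf intF by (simp add: has_bochner_integral_iff)
  then have "(\<lambda>j. pochhammer A j / fact j * Beta (B + real j) (C - B) / Beta B (C - B)) sums
      (Beta B (C - A - B) / Beta B (C - B))"
    by (rule sums_divide)
  moreover have "Beta B (C - B) > 0"
    using B C by (simp add: Beta_def)
  ultimately show ?thesis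
    using B C by (simp add: Beta_plus_of_nat_left field_simps)
qed

section \<open>Moments of the hypergeometric weight\<close>

lemma summable_hypergeometric:
  fixes A B C z :: real
  assumes C: "C > 0" and z: "\<bar>z\<bar> < 1"
  shows "summable (\<lambda>j. pochhammer A j * pochhammer B j / pochhammer C j * (z ^ j / fact j))"
proof -
  define u where "u = (\<lambda>j. pochhammer A j * pochhammer B j / pochhammer C j * (z ^ j / fact j))"
  define r where "r = (\<lambda>j::nat. (A + j) * (B + j) / ((C + j) * (1 + j)) * z)"
  have step: "u (Suc j) = r j * u j" for j
    by (simp add: u_def r_def pochhammer_rec' field_simps)
  have "(\<lambda>j. (A + real j) * (B + real j) / ((C + real j) * (1 + real j))) \<longlonglongrightarrow> 1"
    by real_asymp
  then have "(\<lambda>j. \<bar>r j\<bar>) \<longlonglongrightarrow> \<bar>1 * z\<bar>"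
    unfolding r_def by (intro tendsto_intros)
  moreover have "\<bar>1 * z\<bar> < (1 + \<bar>z\<bar>) / 2"
    using z by simp
  ultimately have "eventually (\<lambda>j. \<bar>r j\<bar> < (1 + \<bar>z\<bar>) / 2) sequentially"
    by (rule order_tendstoD)
  then obtain N where N: "\<And>j. j \<ge> N \<Longrightarrow> \<bar>r j\<bar> < (1 + \<bar>z\<bar>) / 2"
    by (auto simp: eventually_sequentially)
  have "summable u"
  proof (rule summable_ratio_test)
    show "(1 + \<bar>z\<bar>) / 2 < 1" using z by simp
    show "norm (u (Suc j)) \<le> (1 + \<bar>z\<bar>) / 2 * norm (u j)" if "j \<ge> N" for j
      using N[OF that] unfolding step real_norm_def abs_mult by (intro mult_right_mono) auto
  qed
  then show ?thesis unfolding u_def .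
qed

text \<open>The bound on \<open>d\<close> is \<open>d > b - 1\<close> rather than
  \<open>d > b\<close> so that the second weight, where \<open>b + 1\<close> replaces
  \<open>b\<close>, is covered. The parameter \<open>d - b\<close> may then lie in (-1, 0), which
  Gauss's theorem tolerates in its first slot; \<open>c - b\<close> stays positive and takes the
  second.\<close>

lemma hg_weight_moments:
  fixes a b c d :: real
  assumes a: "a > 0" and b: "b > 0" and c: "c > b" and d: "d > 0" "d > b - 1"
    and \<delta>: "c + d - a - b > 0"
  shows "has_bochner_integral unit_interval_measure (\<lambda>x. x ^ k * hg_weight a b c d x)
           (pochhammer a k * pochhammer b k / (pochhammer c k * pochhammer d k))"
proof -
  define \<delta> where "\<delta> = c + d - a - b"
  define K where "K = Gamma c * Gamma d / (Gamma a * Gamma b * Gamma \<delta>)"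
  \<comment> \<open>The Beta integral of term \<open>j\<close> equals (\<delta>)_j / (C)_j times the
    one of term 0. Its numerator cancels the (\<delta>)_j of the weight's series, so
    \<open>C\<close> becomes the lower parameter in Gauss's theorem.\<close>
  define C where "C = \<delta> + (a + real k)"
  define v where "v = (\<lambda>j. K * (pochhammer (c - b) j * pochhammer (d - b) j / pochhammer \<delta> j / fact j))"
  define f where "f = (\<lambda>j x. v j * (x powr ((a + real k) - 1) * (1 - x) powr ((\<delta> + real j) - 1)))"
  define \<sigma> :: real where "\<sigma> = (if d - b \<ge> 0 then 1 else -1)"
  note \<delta>_pos = \<delta>[folded \<delta>_def]
  have K: "K > 0"
    using a b c d \<delta>_pos by (simp add: K_def)
  have intf: "has_bochner_integral unit_interval_measure (f j) (v j * Beta (a + real k) (\<delta> + real j))" for j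
    unfolding f_def using a \<delta>_pos
    by (intro has_bochner_integral_mult_right has_bochner_integral_Beta) auto
  have sgn: "0 \<le> \<sigma> * f (Suc j) x" for j x
  proof -
    \<comment> \<open>Only this factor of \<open>f (Suc j) x\<close> can be negative, and its sign
      does not depend on \<open>j\<close>.\<close>
    have "0 \<le> \<sigma> * pochhammer (d - b) (Suc j)"
      using sgn_pochhammer_Suc[of "d - b" j] d by (auto simp: \<sigma>_def sgn_if split: if_splits)
    moreover have "0 \<le> K * (pochhammer (c - b) (Suc j) / pochhammer \<delta> (Suc j) / fact (Suc j)) *
        (x powr ((a + real k) - 1) * (1 - x) powr ((\<delta> + real (Suc j)) - 1))"
      using K c \<delta>_pos
      by (intro mult_nonneg_nonneg divide_nonneg_nonneg pochhammer_nonneg) auto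
    ultimately have "0 \<le> (\<sigma> * pochhammer (d - b) (Suc j)) *
        (K * (pochhammer (c - b) (Suc j) / pochhammer \<delta> (Suc j) / fact (Suc j)) *
        (x powr ((a + real k) - 1) * (1 - x) powr ((\<delta> + real (Suc j)) - 1)))"
      by (rule mult_nonneg_nonneg)
    then show ?thesis
      by (simp only: f_def v_def times_divide_eq_right times_divide_eq_left ac_simps)
  qed
  have sums: "(\<lambda>j. f j x) sums (x ^ k * hg_weight a b c d x)" if "x \<in> {0<..<1}" for x
  proof -
    have x: "0 < x" "x < 1" using that by auto
    define u where "u = (\<lambda>j. pochhammer (c - b) j * pochhammer (d - b) j / pochhammer \<delta> j * ((1 - x) ^ j / fact j))"
    have "u sums hypergeom [c - b, d - b] [\<delta>] (1 - x)"
      using summable_hypergeometric[of \<delta> "1 - x" "c - b" "d - b"] \<delta>_pos x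
      by (simp add: hypergeom_def u_def summable_sums)
    then have "(\<lambda>j. (x ^ k * K * x powr (a - 1) * (1 - x) powr (\<delta> - 1)) * u j) sums
        ((x ^ k * K * x powr (a - 1) * (1 - x) powr (\<delta> - 1)) * hypergeom [c - b, d - b] [\<delta>] (1 - x))"
      by (rule sums_mult)
    moreover have "(x ^ k * K * x powr (a - 1) * (1 - x) powr (\<delta> - 1)) * hypergeom [c - b, d - b] [\<delta>] (1 - x)
        = x ^ k * hg_weight a b c d x"
      by (simp add: hg_weight_def K_def \<delta>_def Let_def)
    moreover have "(x ^ k * K * x powr (a - 1) * (1 - x) powr (\<delta> - 1)) * u j = f j x" for j
    proof -
      have "x powr ((a + real k) - 1) = x ^ k * x powr (a - 1)"
        using x by (simp add: algebra_simps flip: powr_realpow powr_add)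
      moreover have "(1 - x) powr ((\<delta> + real j) - 1) = (1 - x) ^ j * (1 - x) powr (\<delta> - 1)"
        using x by (simp add: algebra_simps flip: powr_realpow powr_add)
      ultimately show ?thesis
        by (simp add: f_def v_def u_def)
    qed
    ultimately show ?thesis by simp
  qed
  have C_pos: "C > c - b" "C > (d - b) + (c - b)"
    using a b d by (auto simp: C_def \<delta>_def)
  have "(\<lambda>j. K * Beta \<delta> (a + real k) * (pochhammer (d - b) j * pochhammer (c - b) j / (pochhammer C j * fact j)))
      sums (K * Beta \<delta> (a + real k) * (Beta (c - b) (C - (d - b) - (c - b)) / Beta (c - b) (C - (c - b))))"
    using c d C_pos by (intro sums_mult Gauss_summation) auto
  moreover have "K * Beta \<delta> (a + real k) * (pochhammer (d - b) j * pochhammer (c - b) j / (pochhammer C j * fact j))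
      = integral\<^sup>L unit_interval_measure (f j)" for j
  proof -
    have "integral\<^sup>L unit_interval_measure (f j) = v j * Beta (\<delta> + real j) (a + real k)"
      using intf[of j] by (simp add: has_bochner_integral_iff Beta_commute)
    also have "\<dots> = v j * (pochhammer \<delta> j / pochhammer C j * Beta \<delta> (a + real k))"
      using a \<delta>_pos by (subst Beta_plus_of_nat_left) (auto simp: C_def)
    finally show ?thesis
      using pochhammer_pos[OF \<delta>_pos, of j] by (simp add: v_def field_simps)
  qed
  moreover have "K * Beta \<delta> (a + real k) * (Beta (c - b) (C - (d - b) - (c - b)) / Beta (c - b) (C - (c - b)))
      = pochhammer a k * pochhammer b k / (pochhammer c k * pochhammer d k)"
  proof -
    \<comment> \<open>With these arguments the Gamma values at \<delta>, \<open>c - b\<close> and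
      \<open>C\<close> cancel, and \<open>K\<close> supplies the Gamma values that turn the
      remaining ones into rising factorials.\<close>
    have C1: "C - (d - b) - (c - b) = b + real k" "C - (c - b) = d + real k"
      "c - b + (b + real k) = c + real k" "c - b + (d + real k) = C" "\<delta> + (a + real k) = C"
      by (auto simp: C_def \<delta>_def)
    have "C > 0" using C_pos c by simp
    moreover have "a \<notin> \<int>\<^sub>\<le>\<^sub>0" "b \<notin> \<int>\<^sub>\<le>\<^sub>0" "c \<notin> \<int>\<^sub>\<le>\<^sub>0" "d \<notin> \<int>\<^sub>\<le>\<^sub>0"
      using a b c d by (auto dest: nonpos_Ints_nonpos)
    moreover have "Gamma (c - b) > 0" "Gamma \<delta> > 0" "Gamma (c + real k) > 0" "Gamma (d + real k) > 0"
      "Gamma a > 0" "Gamma b > 0" "Gamma c > 0" "Gamma d > 0"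
      using a b c d \<delta>_pos by (auto intro!: Gamma_real_pos)
    moreover have "Gamma C \<noteq> 0"
      using Gamma_real_pos[OF \<open>C > 0\<close>] by simp
    ultimately show ?thesis
      unfolding C1 Beta_def K_def by (simp add: pochhammer_Gamma field_simps)
  qed
  ultimately have "(\<lambda>j. integral\<^sup>L unit_interval_measure (f j)) sums
      (pochhammer a k * pochhammer b k / (pochhammer c k * pochhammer d k))"
    by simp
  then show ?thesis
    by (intro has_bochner_integral_sums_one_signed[where \<sigma> = \<sigma> and f = f])
       (use intf sgn sums in \<open>auto simp: has_bochner_integral_iff \<sigma>_def space_restrict_space\<close>)
qed

section \<open>Finite differences and rising factorials\<close>

lemma alternating_binomial_sum_Suc:
  fixes f :: "nat \<Rightarrow> real"
  shows "(\<Sum>i\<le>Suc n. (-1) ^ i * real (Suc n choose i) * f i) =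
         (\<Sum>i\<le>n. (-1) ^ i * real (n choose i) * (f i - f (Suc i)))"
proof -
  \<comment> \<open>The added term vanishes, as \<open>n choose Suc n\<close> is 0. After the index
    shift both sums run over the same range and Pascal's rule applies termwise.\<close>
  have "(\<Sum>i\<le>n. (-1) ^ i * real (n choose i) * f i) = (\<Sum>i\<le>Suc n. (-1) ^ i * real (n choose i) * f i)"
    by simp
  also have "\<dots> = f 0 + (\<Sum>i\<le>n. (-1) ^ Suc i * real (n choose Suc i) * f (Suc i))"
    by (subst sum.atMost_Suc_shift) simp
  finally show ?thesis
    by (subst sum.atMost_Suc_shift) (simp add: algebra_simps sum.distrib sum_subtractf sum_negf)
qed

text \<open>Substituting x + 1 preserves the leading coefficient, so the top terms cancel. If the
  degree were still the same, the vanishing top coefficient would make the difference 0, whose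
  degree is 0.\<close>

lemma degree_diff_shift_less:
  fixes p :: "real poly"
  assumes "degree p > 0"
  shows "degree (p - pcompose p [:1, 1:]) < degree p"
proof -
  have deg: "degree (pcompose p [:1, 1:]) = degree p"
    by (simp add: degree_pcompose)
  then have "coeff (pcompose p [:1, 1:]) (degree p) = lead_coeff p"
    using lead_coeff_comp[of "[:1, 1::real:]" p] by simp
  moreover have "degree (p - pcompose p [:1, 1:]) \<le> degree p"
    using degree_diff_le_max[of p "pcompose p [:1, 1:]"] deg by simp
  ultimately show ?thesis
    by (metis assms cancel_comm_monoid_add_class.diff_cancel coeff_diff degree_0
        le_neq_implies_less leading_coeff_0_iff)
qed

lemma alternating_binomial_sum_poly_eq_0:
  fixes p :: "real poly"
  assumes "degree p < n"
  shows "(\<Sum>i\<le>n. (-1) ^ i * real (n choose i) * poly p (real i)) = 0"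
  using assms
proof (induction n arbitrary: p)
  case 0
  then show ?case by simp
next
  case (Suc n)
  let ?q = "p - pcompose p [:1, 1:]"
  have "(\<Sum>i\<le>Suc n. (-1) ^ i * real (Suc n choose i) * poly p (real i)) =
      (\<Sum>i\<le>n. (-1) ^ i * real (n choose i) * poly ?q (real i))"
    by (subst alternating_binomial_sum_Suc) (simp add: poly_pcompose add.commute)
  also have "\<dots> = 0"
  \<comment> \<open>For a constant the degree cannot drop further, as \<open>degree 0\<close> is 0;
    here the difference itself vanishes.\<close>
  proof (cases "degree p = 0")
    case True
    then have "?q = 0"
      by (metis degree_eq_zeroE diff_self pcompose_const)
    then show ?thesis by simp
  next
    case False
    then show ?thesis
      using Suc.IH[of ?q] degree_diff_shift_less[of p] Suc.prems by simp
  qed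
  finally show ?case .
qed

text \<open>Rising factorials formed in the polynomial ring exhibit the summands below as values of
  a polynomial at the summation index.\<close>

lemma poly_pochhammer_linear:
  fixes u x :: real
  shows "poly (pochhammer [:u, 1:] k) x = pochhammer (u + x) k"
  by (induction k) (simp_all add: pochhammer_rec' of_nat_poly algebra_simps)

lemma degree_pochhammer_linear_le: "degree (pochhammer [:u, 1::real:] k) \<le> k"
proof (induction k)
  case (Suc k)
  have "degree ([:u, 1:] + of_nat k :: real poly) \<le> 1"
    by (simp add: of_nat_poly)
  then show ?case
    unfolding pochhammer_rec' by (intro order.trans[OF degree_mult_le]) (use Suc in simp)
qed simp

lemma pochhammer_neg_of_nat_div_fact:
  "pochhammer (- real n) i / fact i = (-1) ^ i * real (n choose i)"
  by (simp add: binomial_gbinomial gbinomial_pochhammer flip: mult.assoc power_mult_distrib)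

text \<open>Split (c)_(m+i) once after \<open>m\<close> and once after \<open>i + k\<close> factors.
  The right-hand side is polynomial in \<open>i\<close>, of degree \<open>m - k\<close>: an upper
  parameter \<open>c + m\<close> absorbs the moment's denominator.\<close>

lemma pochhammer_shift_ratio:
  fixes c :: real
  assumes "c > 0" "k \<le> m"
  shows "pochhammer (c + real m) i / pochhammer c (i + k) =
         pochhammer (c + real k + real i) (m - k) / pochhammer c m"
proof -
  have "pochhammer c (m + i) = pochhammer c m * pochhammer (c + real m) i"
    by (rule pochhammer_product')
  moreover have "pochhammer c (m + i) = pochhammer c (i + k) * pochhammer (c + real (i + k)) (m + i - (i + k))"
    using assms by (intro pochhammer_product) simp
  moreover have "m + i - (i + k) = m - k" by simp
  ultimately have "pochhammer c m * pochhammer (c + real m) i =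
      pochhammer c (i + k) * pochhammer (c + real k + real i) (m - k)"
    by (simp add: add_ac)
  then show ?thesis
    using pochhammer_pos[OF assms(1), of m] pochhammer_pos[OF assms(1), of "i + k"]
    by (simp add: field_simps)
qed

text \<open>Up to the alternating binomial weights, each summand is a polynomial in \<open>i\<close> of degree \<open>m + m'\<close>.\<close>

lemma hypergeometric_moment_sum_eq_0:
  fixes a b c d :: real
  assumes pos: "a > 0" "b > 0" "c > 0" "d > 0"
    and "k + j \<le> m" "k \<le> m'" "m + m' < n"
  shows "(\<Sum>i\<le>n. pochhammer (- real n) i * pochhammer (c + real m) i * pochhammer (d + real m') i /
              (pochhammer a i * pochhammer b i * fact i) *
            (pochhammer a (i + k) * pochhammer b (i + (k + j)) /
              (pochhammer c (i + (k + j)) * pochhammer d (i + k)))) = 0"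
    (is "(\<Sum>i\<le>n. ?T i) = 0")
proof -
  define p where "p = pochhammer [:a, 1:] k * pochhammer [:b, 1:] (k + j) *
      (pochhammer [:c + real (k + j), 1:] (m - (k + j)) * pochhammer [:d + real k, 1:] (m' - k))"
  \<comment> \<open>By \<open>k + j \<le> m\<close> and \<open>k \<le> m'\<close> neither
    subtraction is truncated, so the bound equals \<open>m + m'\<close>.\<close>
  have "degree p \<le> k + (k + j) + ((m - (k + j)) + (m' - k))"
    unfolding p_def
    by (intro order.trans[OF degree_mult_le] add_mono degree_pochhammer_linear_le)
  then have deg: "degree p < n"
    using assms by simp
  have "?T i = ((-1) ^ i * real (n choose i) * poly p (real i)) / (pochhammer c m * pochhammer d m')" for i
  proof -
    have "?T i = (pochhammer (- real n) i / fact i) *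
        (pochhammer a (i + k) / pochhammer a i) * (pochhammer b (i + (k + j)) / pochhammer b i) *
        (pochhammer (c + real m) i / pochhammer c (i + (k + j))) *
        (pochhammer (d + real m') i / pochhammer d (i + k))"
      by (simp add: mult_ac)
    also have "pochhammer a (i + k) / pochhammer a i = pochhammer (a + real i) k"
      using pochhammer_pos[OF pos(1), of i] by (simp add: pochhammer_product')
    also have "pochhammer b (i + (k + j)) / pochhammer b i = pochhammer (b + real i) (k + j)"
      using pochhammer_pos[OF pos(2), of i] by (simp only: pochhammer_product') simp
    also note pochhammer_neg_of_nat_div_fact
    also note pochhammer_shift_ratio[OF pos(3) \<open>k + j \<le> m\<close>]
    also note pochhammer_shift_ratio[OF pos(4) \<open>k \<le> m'\<close>]
    finally show ?thesis
      by (simp add: p_def poly_pochhammer_linear)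
  qed
  then have "(\<Sum>i\<le>n. ?T i) =
      (\<Sum>i\<le>n. (-1) ^ i * real (n choose i) * poly p (real i)) / (pochhammer c m * pochhammer d m')"
    by (simp only: sum_divide_distrib)
  then show ?thesis
    using alternating_binomial_sum_poly_eq_0[OF deg] by simp
qed

section \<open>Monic terminating hypergeometric polynomials\<close>

text \<open>Since (-n)_n = (-1)^n n!, the prefactor is the reciprocal of the sum's coefficient at
  x^n, provided the rising factorials involved are nonzero.\<close>

definition hypergeom_3F2_poly :: "nat \<Rightarrow> real \<Rightarrow> real \<Rightarrow> real \<Rightarrow> real \<Rightarrow> real poly" where
  "hypergeom_3F2_poly n a b e f =
     smult ((-1) ^ n * pochhammer a n * pochhammer b n / (pochhammer e n * pochhammer f n))
       (\<Sum>i\<le>n. monom (pochhammer (- real n) i * pochhammer e i * pochhammer f i /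
                        (pochhammer a i * pochhammer b i * fact i)) i)"

lemma coeff_hypergeom_3F2_poly:
  "coeff (hypergeom_3F2_poly n a b e f) i =
     (if i \<le> n then (-1) ^ n * pochhammer a n * pochhammer b n / (pochhammer e n * pochhammer f n) *
        (pochhammer (- real n) i * pochhammer e i * pochhammer f i /
                        (pochhammer a i * pochhammer b i * fact i)) else 0)"
  by (simp add: hypergeom_3F2_poly_def coeff_sum)

lemma coeff_hypergeom_3F2_poly_top:
  assumes "a > 0" "b > 0" "pochhammer e n \<noteq> 0" "pochhammer f n \<noteq> 0"
  shows "coeff (hypergeom_3F2_poly n a b e f) n = 1"
proof -
  have "pochhammer (- real n) n = (-1) ^ n * fact n"
    using pochhammer_neg_of_nat_div_fact[of n n] by (simp add: field_simps)
  moreover have "(-1::real) ^ n * (-1) ^ n = 1"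
    by (simp flip: power_mult_distrib)
  ultimately show ?thesis
    using assms pochhammer_pos[of a n] pochhammer_pos[of b n]
    by (simp add: coeff_hypergeom_3F2_poly field_simps)
qed

text \<open>Moves the growing parameter into the last slot, so that one limit lemma serves both
  \<open>c\<close> and \<open>d\<close> tending to infinity.\<close>

lemma hypergeom_3F2_poly_commute: "hypergeom_3F2_poly n a b e f = hypergeom_3F2_poly n a b f e"
  by (simp add: hypergeom_3F2_poly_def mult_ac)

lemma poly_hypergeom_3F2_poly:
  "poly (hypergeom_3F2_poly n a b e f) x =
     (-1) ^ n * pochhammer a n * pochhammer b n / (pochhammer e n * pochhammer f n) *
       (\<Sum>i\<le>n. pochhammer (- real n) i * pochhammer e i * pochhammer f i /
                        (pochhammer a i * pochhammer b i * fact i) * x ^ i)"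
  by (simp add: hypergeom_3F2_poly_def poly_sum poly_monom)

section \<open>Uniqueness from a triangular system\<close>

text \<open>Peel off the top coefficient with the monic \<open>P n\<close> and induct. Stating the
  bound through coefficients instead of \<open>degree D < n\<close> lets the induction start at
  \<open>n = 0\<close> with the zero polynomial.\<close>

lemma monic_expansion:
  fixes P :: "nat \<Rightarrow> real poly"
  assumes P: "\<And>m. degree (P m) = m" "\<And>m. lead_coeff (P m) = 1"
    and D: "\<And>i. i \<ge> n \<Longrightarrow> coeff D i = 0"
  shows "\<exists>q. D = (\<Sum>i<n. smult (q i) (P i))"
  using D
proof (induction n arbitrary: D)
  case 0
  then show ?case by (simp add: poly_eq_iff)
next
  case (Suc n)
  define E where "E = D - smult (coeff D n) (P n)"
  have "coeff E i = 0" if "i \<ge> n" for i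
  proof (cases "i = n")
    case True
    then show ?thesis using P[of n] by (simp add: E_def)
  next
    case False
    then show ?thesis
      using that Suc.prems[of i] P(1)[of n] by (simp add: E_def coeff_eq_0)
  qed
  then obtain q where q: "E = (\<Sum>i<n. smult (q i) (P i))"
    using Suc.IH by blast
  have "(\<Sum>i<n. smult ((q(n := coeff D n)) i) (P i)) = E"
    unfolding q by (intro sum.cong) auto
  then have "D = (\<Sum>i<Suc n. smult ((q(n := coeff D n)) i) (P i))"
    by (simp add: E_def)
  then show ?case by blast
qed

text \<open>The matrix of the values \<open>L i (P m)\<close> is triangular with nonzero diagonal,
  so forward substitution annihilates the coefficients of \<open>D\<close> in the basis
  \<open>P\<close>.\<close>

lemma triangular_functionals_zero:
  fixes P :: "nat \<Rightarrow> real poly" and L :: "nat \<Rightarrow> real poly \<Rightarrow> real"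
  assumes P: "\<And>m. degree (P m) = m" "\<And>m. lead_coeff (P m) = 1"
    and D: "\<And>i. i \<ge> n \<Longrightarrow> coeff D i = 0"
    and L_add: "\<And>i p q. L i (p + q) = L i p + L i q"
    and L_smult: "\<And>i c p. L i (smult c p) = c * L i p"
    and L_zero: "\<And>i m. i < m \<Longrightarrow> L i (P m) = 0"
    and L_nz: "\<And>i. L i (P i) \<noteq> 0"
    and LD: "\<And>i. i < n \<Longrightarrow> L i D = 0"
  shows "D = 0"
proof -
  obtain q where q: "D = (\<Sum>i<n. smult (q i) (P i))"
    using monic_expansion[where P = P, OF P D] by blast
  have L_0: "L i 0 = 0" for i
    using L_smult[of i 0 0] by simp
  have L_sum: "L i (\<Sum>m\<in>S. g m) = (\<Sum>m\<in>S. L i (g m))" if "finite S" for i S and g :: "nat \<Rightarrow> real poly"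
    using that by induction (simp_all add: L_0 L_add)
  have "q i = 0" if "i < n" for i
    using that
  proof (induction i rule: less_induct)
    case (less i)
    have "0 = (\<Sum>m<n. q m * L i (P m))"
      using LD[OF less.prems] by (simp add: q L_sum L_smult)
    \<comment> \<open>Terms with \<open>m < i\<close> vanish since \<open>q m = 0\<close> by
      induction, those with \<open>m > i\<close> by \<open>L_zero\<close>.\<close>
    also have "\<dots> = (\<Sum>m<n. if m = i then q i * L i (P i) else 0)"
      using less L_zero by (intro sum.cong refl) (auto simp: neq_iff)
    also have "\<dots> = q i * L i (P i)"
      using less.prems by simp
    finally show ?case using L_nz by simp
  qed
  then show ?thesis by (simp add: q)
qed

section \<open>Limits as a parameter tends to infinity\<close>

lemma pochhammer_shift_asymp: "((\<lambda>d::real. pochhammer (d + u) i / d ^ i) \<longlongrightarrow> 1) at_top"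
proof (induction i)
  case 0
  then show ?case by simp
next
  case (Suc i)
  have "((\<lambda>d::real. (d + u + real i) / d) \<longlongrightarrow> 1) at_top"
    by real_asymp
  from tendsto_mult[OF this Suc] show ?case
    by (simp add: pochhammer_rec')
qed

lemma hypergeom_2F2_terminating:
  "hypergeom [- real n, e] [a, b] x =
     (\<Sum>i\<le>n. pochhammer (- real n) i * pochhammer e i / (pochhammer a i * pochhammer b i) * (x ^ i / fact i))"
  unfolding hypergeom_def
  by (subst suminf_finite[where N = "{..n}"]) (auto simp: pochhammer_of_nat_eq_0_iff)

lemma hypergeom_3F2_poly_limit:
  fixes a b e u x :: real
  shows "((\<lambda>d. d ^ n * poly (hypergeom_3F2_poly n a b e (d + u)) (x / d)) \<longlongrightarrow>
    (-1) ^ n * pochhammer a n * pochhammer b n / pochhammer e n * hypergeom [- real n, e] [a, b] x) at_top"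
proof -
  define K where "K = (-1) ^ n * pochhammer a n * pochhammer b n / pochhammer e n"
  define g where "g = (\<lambda>i. pochhammer (- real n) i * pochhammer e i / (pochhammer a i * pochhammer b i) * (x ^ i / fact i))"
  \<comment> \<open>All dependence on \<open>d\<close> passes through \<open>h\<close>: the factor
    d^n combines with the normalising (d+u)_n to \<open>1 / h n d\<close>, and (x/d)^i with (d+u)_i
    to \<open>x ^ i * h i d\<close>.\<close>
  define h where "h = (\<lambda>i d. pochhammer (d + u) i / d ^ i)"
  have h: "(h i \<longlongrightarrow> 1) at_top" for i
    unfolding h_def by (rule pochhammer_shift_asymp)
  have "((\<lambda>d. K / h n d * (\<Sum>i\<le>n. g i * h i d)) \<longlongrightarrow> K / 1 * (\<Sum>i\<le>n. g i * 1)) at_top"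
    by (intro tendsto_intros h) simp
  moreover have "eventually (\<lambda>d. K / h n d * (\<Sum>i\<le>n. g i * h i d) =
      d ^ n * poly (hypergeom_3F2_poly n a b e (d + u)) (x / d)) at_top"
    using eventually_gt_at_top[of 0]
  proof eventually_elim
    case (elim d)
    have "(\<Sum>i\<le>n. g i * h i d) = (\<Sum>i\<le>n. pochhammer (- real n) i * pochhammer e i * pochhammer (d + u) i /
                        (pochhammer a i * pochhammer b i * fact i) * (x / d) ^ i)"
      by (intro sum.cong refl) (simp add: g_def h_def power_divide)
    then show ?case
      by (simp add: poly_hypergeom_3F2_poly K_def h_def)
  qed
  ultimately have "((\<lambda>d. d ^ n * poly (hypergeom_3F2_poly n a b e (d + u)) (x / d)) \<longlongrightarrow>
      K / 1 * (\<Sum>i\<le>n. g i * 1)) at_top"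
    by (rule Lim_transform_eventually)
  then show ?thesis
    by (simp add: K_def g_def hypergeom_2F2_terminating)
qed

section \<open>Identification of the 2-orthogonal polynomials\<close>

text \<open>Since (b+1)_k = (b)_(k+1) / b, and likewise for \<open>c\<close>, both weights obey one
  formula: up to the factor (c/b)^j, passing to the second weight shifts the indices at
  \<open>b\<close> and \<open>c\<close> by one.\<close>

lemma hg_weight_vec_moments:
  fixes a b c d :: real
  assumes "a > 0" "b > 0" "c > max a b" "d > max a b" "j \<in> {0, 1}"
  shows "has_bochner_integral unit_interval_measure (\<lambda>x. x ^ k * hg_weight_vec a b c d j x)
           ((c / b) ^ j * (pochhammer a k * pochhammer b (k + j) / (pochhammer c (k + j) * pochhammer d k)))"
proof (cases "j = 0")
  case True
  then show ?thesis
    using hg_weight_moments[of a b c d k] assms by (simp add: hg_weight_vec_def)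
next
  case False
  then have j: "j = 1" using assms by simp
  have pos: "c > 0" using assms by simp
  have "has_bochner_integral unit_interval_measure (\<lambda>x. x ^ k * hg_weight a (b + 1) (c + 1) d x)
      (pochhammer a k * pochhammer (b + 1) k / (pochhammer (c + 1) k * pochhammer d k))"
    using assms by (intro hg_weight_moments) auto
  moreover have "pochhammer a k * pochhammer (b + 1) k / (pochhammer (c + 1) k * pochhammer d k) =
      (c / b) ^ j * (pochhammer a k * pochhammer b (k + j) / (pochhammer c (k + j) * pochhammer d k))"
    using assms pos by (simp add: j pochhammer_rec)
  ultimately show ?thesis
    by (simp add: hg_weight_vec_def j)
qed

lemma has_bochner_integral_power_poly_mult:
  fixes w :: "real \<Rightarrow> real"
  assumes "\<And>k. has_bochner_integral M (\<lambda>x. x ^ k * w x) (\<mu> k)"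
  shows "has_bochner_integral M (\<lambda>x. x ^ k * poly p x * w x) (\<Sum>i\<le>degree p. coeff p i * \<mu> (i + k))"
proof -
  have "has_bochner_integral M (\<lambda>x. \<Sum>i\<le>degree p. coeff p i * (x ^ (i + k) * w x))
      (\<Sum>i\<le>degree p. coeff p i * \<mu> (i + k))"
    by (intro has_bochner_integral_sum has_bochner_integral_mult_right assms)
  moreover have "(\<Sum>i\<le>degree p. coeff p i * (x ^ (i + k) * w x)) = x ^ k * poly p x * w x" for x
    by (simp add: poly_altdef sum_distrib_left sum_distrib_right power_add mult_ac)
  ultimately show ?thesis by simp
qed

lemma monic_2OPS_hg_weight_unique:
  fixes a b c d :: real
  assumes a: "a > 0" and b: "b > 0" and c: "c > max a b" and d: "d > max a b"
    and P: "monic_2OPS (hg_weight_vec a b c d) P"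
  shows "P n = hypergeom_3F2_poly n a b (c + real (n div 2)) (d + real ((n - 1) div 2))"
proof -
  define Q where "Q = hypergeom_3F2_poly n a b (c + real (n div 2)) (d + real ((n - 1) div 2))"
  define w where "w = hg_weight_vec a b c d"
  \<comment> \<open>The single index \<open>i = 2 * k + j\<close> encodes the pair (k, j). The
    orthogonality conditions then say that \<open>L i (P n)\<close> is 0 for \<open>i < n\<close>
    and nonzero for \<open>i = n\<close>, which is the triangular shape.\<close>
  define L where "L = (\<lambda>i p. \<integral>x. x ^ (i div 2) * poly p x * w (i mod 2) x \<partial>unit_interval_measure)"
  have pos: "c > 0" "d > 0" using a c d by auto
  have mod: "i mod 2 \<in> {0, 1}" for i :: nat by auto
  note int = has_bochner_integral_power_poly_mult[OF hg_weight_vec_moments[OF a b c d mod], folded w_def]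
  have L_int: "integrable unit_interval_measure (\<lambda>x. x ^ (i div 2) * poly p x * w (i mod 2) x)" for i p
    using int has_bochner_integral_iff by blast
  have monic: "degree (P m) = m" "lead_coeff (P m) = 1" for m
    using P unfolding monic_2OPS_def by blast+
  have L_set: "L i p = (LBINT x:{0<..<1}. x ^ (i div 2) * poly p x * w (i mod 2) x)" for i p
    by (simp add: L_def integral_restrict_space set_lebesgue_integral_def)
  note orth = P[unfolded monic_2OPS_def, THEN conjunct2, THEN bspec, OF mod, THEN spec, THEN spec,
      folded w_def]
  have Q_top: "coeff Q n = 1"
    unfolding Q_def using a b pos
    by (intro coeff_hypergeom_3F2_poly_top) (auto intro!: less_imp_neq[symmetric] pochhammer_pos)
  have Q_0: "coeff Q i = 0" if "i > n" for i
    using that by (simp add: Q_def coeff_hypergeom_3F2_poly)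
  have Q_deg: "degree Q = n"
    using Q_top Q_0 by (intro antisym degree_le le_degree) auto
  have LQ: "L i Q = 0" if "i < n" for i
  proof -
    define k j where "k = i div 2" and "j = i mod 2"
    \<comment> \<open>\<open>K\<close> joins the normalisation of \<open>Q\<close> with the moment
      factor (c/b)^j; both are independent of the summation index.\<close>
    define K where "K = (-1) ^ n * pochhammer a n * pochhammer b n /
      (pochhammer (c + real (n div 2)) n * pochhammer (d + real ((n - 1) div 2)) n) * (c / b) ^ j"
    have "i = 2 * k + j" "j \<le> 1" by (auto simp: k_def j_def)
    \<comment> \<open>This is what the two floors are chosen for: \<open>k + j\<close> is i/2
      rounded up, \<open>k\<close> is i/2 rounded down, and for positive \<open>n\<close> the floors
      add up to \<open>n - 1\<close>.\<close>
    then have "k + j \<le> n div 2" "k \<le> (n - 1) div 2" "n div 2 + (n - 1) div 2 < n"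
      using that by linarith+
    note zero = hypergeometric_moment_sum_eq_0[OF a b pos this]
    have "L i Q = (\<Sum>l\<le>n. coeff Q l * ((c / b) ^ j *
        (pochhammer a (l + k) * pochhammer b (l + k + j) / (pochhammer c (l + k + j) * pochhammer d (l + k)))))"
      using int[of "i div 2" Q i] by (simp only: L_def has_bochner_integral_iff Q_deg k_def j_def)
    also have "\<dots> = (\<Sum>l\<le>n. K * (pochhammer (- real n) l * pochhammer (c + real (n div 2)) l *
           pochhammer (d + real ((n - 1) div 2)) l / (pochhammer a l * pochhammer b l * fact l) *
            (pochhammer a (l + k) * pochhammer b (l + (k + j)) /
              (pochhammer c (l + (k + j)) * pochhammer d (l + k)))))"
      by (intro sum.cong refl) (simp add: Q_def coeff_hypergeom_3F2_poly K_def add.assoc mult_ac)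
    also have "\<dots> = 0"
      unfolding sum_distrib_left[symmetric] zero by simp
    finally show ?thesis .
  qed
  have "P n - Q = 0"
  proof (rule triangular_functionals_zero[where P = P and L = L and n = n])
    \<comment> \<open>Both polynomials are monic of degree \<open>n\<close>, so their top terms
      cancel.\<close>
    show "coeff (P n - Q) i = 0" if "i \<ge> n" for i
      using that Q_top Q_0[of i] monic[of n] coeff_eq_0[of "P n" i] by (cases "i = n") auto
    show L_add: "L i (p + q) = L i p + L i q" for i p q
      unfolding L_def by (subst Bochner_Integration.integral_add[symmetric])
        (use L_int in \<open>simp_all add: algebra_simps\<close>)
    show L_smult: "L i (smult r p) = r * L i p" for i r p
      unfolding L_def by (subst Bochner_Integration.integral_mult_right_zero[symmetric]) (simp add: mult_ac)
    show L_zero: "L i (P m) = 0" if "i < m" for i m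
      unfolding L_set by (rule orth[THEN conjunct1, THEN mp]) (use that in simp)
    show "L i (P i) \<noteq> 0" for i
      unfolding L_set by (rule orth[THEN conjunct2, THEN mp]) simp
    show "L i (P n - Q) = 0" if "i < n" for i
      using L_add[of i "P n" "smult (-1) Q"] L_smult[of i "-1" Q] L_zero[OF that] LQ[OF that] by simp
  qed (fact monic)+
  then show ?thesis by (simp add: Q_def)
qed

theorem mainTheorem11:
  fixes n :: nat and a b :: real
    and P :: "real \<Rightarrow> real \<Rightarrow> nat \<Rightarrow> real poly"
  assumes "a > 0" and "b > 0"
    and "\<And>c d. c > max a b \<Longrightarrow> d > max a b \<Longrightarrow> monic_2OPS (hg_weight_vec a b c d) (P c d)"
  shows "\<forall>x::real.
           (\<forall>c > max a b.
              ((\<lambda>d. d ^ n * poly (P c d n) (x / d)) \<longlongrightarrow> tricomi_R 0 n a b c x) at_top) \<and>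
           (\<forall>d > max a b.
              ((\<lambda>c. c ^ n * poly (P c d n) (x / c)) \<longlongrightarrow> tricomi_R 1 n a b (d - 1) x) at_top)"
proof (intro allI conjI impI)
  note P_eq = monic_2OPS_hg_weight_unique[OF assms(1,2) _ _ assms(3)]
  fix x :: real
  show "((\<lambda>d. d ^ n * poly (P c d n) (x / d)) \<longlongrightarrow> tricomi_R 0 n a b c x) at_top" if "c > max a b" for c
  proof (rule Lim_transform_eventually)
    show "((\<lambda>d. d ^ n * poly (hypergeom_3F2_poly n a b (c + real (n div 2)) (d + real ((n - 1) div 2)))
          (x / d)) \<longlongrightarrow> tricomi_R 0 n a b c x) at_top"
      unfolding tricomi_R_def Let_def add_0_right by (rule hypergeom_3F2_poly_limit)
    show "eventually (\<lambda>d. d ^ n * poly (hypergeom_3F2_poly n a b (c + real (n div 2)) (d + real ((n - 1) div 2))) (x / d)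
        = d ^ n * poly (P c d n) (x / d)) at_top"
      \<comment> \<open>The explicit form of \<open>P c d n\<close> is available only for
        \<open>d > max a b\<close>, which holds eventually.\<close>
      using eventually_gt_at_top[of "max a b"] by eventually_elim (use that P_eq in simp)
  qed
  show "((\<lambda>c. c ^ n * poly (P c d n) (x / c)) \<longlongrightarrow> tricomi_R 1 n a b (d - 1) x) at_top" if "d > max a b" for d
  proof (rule Lim_transform_eventually)
    let ?e = "d + real ((n - 1) div 2)"
    have *: "tricomi_R 1 n a b (d - 1) x =
        (-1) ^ n * pochhammer a n * pochhammer b n / pochhammer ?e n * hypergeom [- real n, ?e] [a, b] x"
    \<comment> \<open>For positive \<open>n\<close>, d - 1 + floor((n+1)/2) equals d +
      floor((n-1)/2). For \<open>n = 0\<close> the truncated \<open>n - 1\<close> breaks this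
      identity, but both sides are then 1.\<close>
    proof (cases n)
      case 0
      then show ?thesis
        using hypergeom_2F2_terminating[of 0] by (simp add: tricomi_R_def)
    next
      case (Suc m)
      then have "d - 1 + real ((n + 1) div 2) = ?e" by simp
      then show ?thesis by (simp only: tricomi_R_def Let_def)
    qed
    show "((\<lambda>c. c ^ n * poly (hypergeom_3F2_poly n a b ?e (c + real (n div 2))) (x / c))
        \<longlongrightarrow> tricomi_R 1 n a b (d - 1) x) at_top"
      unfolding * by (rule hypergeom_3F2_poly_limit)
    show "eventually (\<lambda>c. c ^ n * poly (hypergeom_3F2_poly n a b ?e (c + real (n div 2))) (x / c)
        = c ^ n * poly (P c d n) (x / c)) at_top"
      using eventually_gt_at_top[of "max a b"]
      by eventually_elim (use that P_eq in \<open>simp add: hypergeom_3F2_poly_commute\<close>)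
  qed
qed

end
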